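(* A crowned section $P$ has a 4-crown stack as retract if and only if there exists a retraction $r : P \to R$ onto a 4-crown stack $R$ such that $R$ contains a split level (with respect to $r$), i.e. some level set $R(\ell)$ of $R$ is a down-split level or an up-split level.
   Context: All posets are finite. $[i,j] = \{i,\dots,j\}$ for integers. The height $h_P$ of a poset $P$ is the maximal length (cardinality minus one) of a chain in $P$. Level sets: $P(0) := \min P$ and $P(k+1) := \min(P \setminus \bigcup_{i=0}^k P(i))$ for $0 \le k < h_P$. For $k \le \ell$, $P(k,\ell) := P(k) \cup P(\ell)$ and $P(k\to\ell) := \bigcup_{i=k}^{\ell} P(i)$; subsets are identified with the induced sub-posets. A retraction of $P$ onto an induced sub-poset $R$ is an idempotent order-preserving map $r : P \to P$ with image $R$; then $R$ is a retract of $P$. For $n \geq 2$, a $2n$-crown is a poset with $2n$ points $x_{i,j}$, $i \in [0,n-1]$, $j \in \{0,1\}$, whose only comparabilities between different points are $x_{0,0} < x_{0,1} > x_{1,0} < \cdots > x_{n-1,0} < x_{n-1,1} > x_{0,0}$. A 4-crown stack is a poset $R$ of height at least 1 such that $R(k,k+1)$ is a 4-crown for all $k \in [0,h_R-1]$, all other comparabilities being induced by transitivity. A poset is of type $33$ if it is the ordinal sum of two 3-element antichains. A section of width three is a poset $P$ of height at least one with carrier $\{c_{k,j} : k \in [0,h_P], j \in \{0,1,2\}\}$ such that: $c_{0,j} < \cdots < c_{h_P,j}$ is a chain for each $j$; $\{c_{k,0},c_{k,1},c_{k,2}\}$ is an antichain for each $k$; the map $c_{k,j} \mapsto c_{k,(j+1)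 \bmod 3}$ is an automorphism of $P$; and $P(k,k+1) \not\simeq 33$ for all $k \in [0,h_P-1]$. (Then $P(k) = \{c_{k,0},c_{k,1},c_{k,2}\}$.) Write $\lambda(c_{k,j}) := k$. A crowned section is a section $P$ of width three for which $P(0,1)$ and $P(h_P-1,h_P)$ are 6-crowns. Let $r : P \to R$ be a retraction of a crowned section onto a 4-crown stack and $R(\ell) = \{a,b\}$ with $\lambda(a) \le \lambda(b)$. $R(\ell)$ is a down-split level if $\ell < h_R$ and $R(0\to\ell) = r[P(0\to\lambda(b))]$; it is an up-split level if $0 < \ell$ and $R(\ell\to h_R) = r[P(\lambda(a)\to h_P)]$. It is a split level if it is a down-split level or an up-split level. *)

theory Defs
  imports Main
begin

text \<open>
  A finite poset is represented by its reflexive order relation \<open>P :: 'a rel\<close>. Its carrier is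
  \<open>Field P\<close>, and \<open>(x, y) \<in> P\<close> means \<open>x \<le> y\<close>. The sub-poset induced on
  \<open>A \<subseteq> Field P\<close> is \<open>Restr P A\<close>.
\<close>

definition finite_poset :: "'a rel \<Rightarrow> bool" where
  "finite_poset P \<longleftrightarrow> finite (Field P) \<and> Partial_order P"

definition automorphism :: "('a \<Rightarrow> 'a) \<Rightarrow> 'a rel \<Rightarrow> bool" where
  "automorphism f P \<longleftrightarrow> bij_betw f (Field P) (Field P) \<and>
     (\<forall>x \<in> Field P. \<forall>y \<in> Field P. (x, y) \<in> P \<longleftrightarrow> (f x, f y) \<in> P)"

definition height :: "'a rel \<Rightarrow> nat" where
  "height P = Max ((\<lambda>C. card C - 1) ` Chains P)"

definition minimals :: "'a rel \<Rightarrow> 'a set \<Rightarrow> 'a set" where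
  "minimals P A = {x \<in> A. \<forall>y \<in> A. (y, x) \<in> P \<longrightarrow> y = x}"

fun level :: "'a rel \<Rightarrow> nat \<Rightarrow> 'a set" where
  "level P 0 = minimals P (Field P)"
| "level P (Suc k) = minimals P (Field P - (\<Union>i \<in> {..k}. level P i))"

text \<open>\<open>level_pair P k l\<close> is the sub-poset $P(k,l)$; \<open>level_range P k l\<close> is the set
  $P(k \to l)$.\<close>

definition level_pair :: "'a rel \<Rightarrow> nat \<Rightarrow> nat \<Rightarrow> 'a rel" where
  "level_pair P k l = Restr P (level P k \<union> level P l)"

definition level_range :: "'a rel \<Rightarrow> nat \<Rightarrow> nat \<Rightarrow> 'a set" where
  "level_range P k l = (\<Union>i \<in> {k..l}. level P i)"

definition retraction :: "('a \<Rightarrow> 'a) \<Rightarrow> 'a rel \<Rightarrow> 'a rel \<Rightarrow> bool" where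
  "retraction r P R \<longleftrightarrow>
     r ` Field P \<subseteq> Field P \<and>
     (\<forall>x \<in> Field P. r (r x) = r x) \<and>
     (\<forall>(x, y) \<in> P. (r x, r y) \<in> P) \<and>
     R = Restr P (r ` Field P)"

definition retract :: "'a rel \<Rightarrow> 'a rel \<Rightarrow> bool" where
  "retract R P \<longleftrightarrow> (\<exists>r. retraction r P R)"

text \<open>\<open>crown n Q\<close> says that \<open>Q\<close> is a $2n$-crown, so the 4-crowns are given by
  \<open>crown 2\<close> and the 6-crowns by \<open>crown 3\<close>.\<close>

definition crown :: "nat \<Rightarrow> 'a rel \<Rightarrow> bool" where
  "crown n Q \<longleftrightarrow> 2 \<le> n \<and>
     (\<exists>x :: nat \<Rightarrow> nat \<Rightarrow> 'a.
        inj_on (\<lambda>(i, j). x i j) ({..<n} \<times> {0, 1}) \<and>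
        Q = Id_on ((\<lambda>(i, j). x i j) ` ({..<n} \<times> {0, 1}))
            \<union> {(x i 0, x i 1) |i. i < n}
            \<union> {(x ((i + 1) mod n) 0, x i 1) |i. i < n})"

definition four_crown_stack :: "'a rel \<Rightarrow> bool" where
  "four_crown_stack R \<longleftrightarrow> finite_poset R \<and> 1 \<le> height R \<and>
     (\<forall>k < height R. crown 2 (level_pair R k (k + 1))) \<and>
     R = (\<Union>k \<in> {..<height R}. level_pair R k (k + 1))\<^sup>+"

definition type33 :: "'a rel \<Rightarrow> bool" where
  "type33 Q \<longleftrightarrow> (\<exists>A B. card A = 3 \<and> card B = 3 \<and> A \<inter> B = {} \<and>
     Q = Id_on (A \<union> B) \<union> A \<times> B)"

text \<open>The labelling \<open>c\<close> of the carrier, with \<open>c k j\<close> for $c_{k,j}$, is part of the structure of a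
  section. The points $c_{k,j}$ are understood to be pairwise distinct.\<close>

definition section_width3 :: "(nat \<Rightarrow> nat \<Rightarrow> 'a) \<Rightarrow> 'a rel \<Rightarrow> bool" where
  "section_width3 c P \<longleftrightarrow> finite_poset P \<and> 1 \<le> height P \<and>
     Field P = (\<lambda>(k, j). c k j) ` ({..height P} \<times> {..<3}) \<and>
     inj_on (\<lambda>(k, j). c k j) ({..height P} \<times> {..<3}) \<and>
     (\<forall>j < 3. \<forall>k < height P. (c k j, c (k + 1) j) \<in> P) \<and>
     (\<forall>k \<le> height P. \<forall>i < 3. \<forall>j < 3. i \<noteq> j \<longrightarrow> (c k i, c k j) \<notin> P) \<and>
     (\<exists>f. automorphism f P \<and> (\<forall>k \<le> height P. \<forall>j < 3. f (c k j) = c k ((j + 1) mod 3))) \<and>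
     (\<forall>k < height P. \<not> type33 (level_pair P k (k + 1)))"

definition crowned_section :: "(nat \<Rightarrow> nat \<Rightarrow> 'a) \<Rightarrow> 'a rel \<Rightarrow> bool" where
  "crowned_section c P \<longleftrightarrow> section_width3 c P \<and>
     crown 3 (level_pair P 0 1) \<and> crown 3 (level_pair P (height P - 1) (height P))"

definition lam :: "(nat \<Rightarrow> nat \<Rightarrow> 'a) \<Rightarrow> 'a rel \<Rightarrow> 'a \<Rightarrow> nat" where
  "lam c P x = (THE k. k \<le> height P \<and> (\<exists>j < 3. x = c k j))"

text \<open>In the following definitions \<open>r\<close> is meant to be a retraction of the crowned section \<open>P\<close>
  (labelled by \<open>c\<close>) onto the 4-crown stack \<open>R\<close>. The level sets of \<open>R\<close> then have exactly two
  elements, so \<open>a\<close> and \<open>b\<close> are determined up to exchange in the case of equal \<open>lam\<close>-values,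
  which does not affect the conditions.\<close>

definition down_split_level ::
  "(nat \<Rightarrow> nat \<Rightarrow> 'a) \<Rightarrow> 'a rel \<Rightarrow> ('a \<Rightarrow> 'a) \<Rightarrow> 'a rel \<Rightarrow> nat \<Rightarrow> bool" where
  "down_split_level c P r R l \<longleftrightarrow> l < height R \<and>
     (\<exists>a b. level R l = {a, b} \<and> lam c P a \<le> lam c P b \<and>
        level_range R 0 l = r ` level_range P 0 (lam c P b))"

definition up_split_level ::
  "(nat \<Rightarrow> nat \<Rightarrow> 'a) \<Rightarrow> 'a rel \<Rightarrow> ('a \<Rightarrow> 'a) \<Rightarrow> 'a rel \<Rightarrow> nat \<Rightarrow> bool" where
  "up_split_level c P r R l \<longleftrightarrow> 0 < l \<and> l \<le> height R \<and>
     (\<exists>a b. level R l = {a, b} \<and> lam c P a \<le> lam c P b \<and>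
        level_range R l (height R) = r ` level_range P (lam c P a) (height P))"

definition split_level ::
  "(nat \<Rightarrow> nat \<Rightarrow> 'a) \<Rightarrow> 'a rel \<Rightarrow> ('a \<Rightarrow> 'a) \<Rightarrow> 'a rel \<Rightarrow> nat \<Rightarrow> bool" where
  "split_level c P r R l \<longleftrightarrow> down_split_level c P r R l \<or> up_split_level c P r R l"

end

theory Submission
  imports Defs
begin

text \<open>
  A 4-crown stack is an ordinal sum of two-element antichains. Hence every retraction onto a
  4-crown stack can be pushed down at the bottom until the lowest level splits, and this works in
  any finite poset. Let \<open>r\<close> be a retraction of \<open>P\<close> onto \<open>R\<close> with bottom
  level \<open>{a, b}\<close>, and choose minimal points \<open>a' \<le> a\<close> and \<open>b' \<le> b\<close> of
  \<open>P\<close>. As \<open>a\<close> and \<open>b\<close> are minimal in \<open>R\<close>, \<open>r\<close> sends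
  \<open>a'\<close> to \<open>a\<close> and \<open>b'\<close> to \<open>b\<close>. Replacing \<open>a\<close> by
  \<open>a'\<close> and \<open>b\<close> by \<open>b'\<close> therefore gives an isomorphic copy of \<open>R\<close>
  that is again a retract.

  Some minimal points of \<open>P\<close> may still be mapped above the bottom level. Each of them can be
  sent to \<open>a'\<close> instead without damaging monotonicity: nothing lies strictly below such a
  point, and the points above it have images above its old image, which lies above \<open>a\<close>. After
  this change all of \<open>P(0)\<close> is mapped onto the bottom level of the stack. In a section of
  width three the minimal points have \<open>\<lambda>\<close>-value 0, so this says that the bottom level is a
  down-split level.

  The modification is carried out in \<open>split_at_bottom\<close>. It rests on
  \<open>four_crown_stack_bottom\<close>, which extracts from the level-wise definition of a stack that its
  two bottom points lie below everything else, and on \<open>four_crown_stack_image\<close>, the invariance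
  of stacks under isomorphism.
\<close>

section \<open>Finite posets and their minimal points\<close>

lemma Field_Restr_refl:
  assumes "refl_on (Field P) P" and "A \<subseteq> Field P"
  shows "Field (Restr P A) = A"
proof
  show "A \<subseteq> Field (Restr P A)"
  proof
    fix x assume "x \<in> A"
    then have "(x, x) \<in> Restr P A" using assms by (auto dest: refl_onD)
    then show "x \<in> Field (Restr P A)" by (rule FieldI1)
  qed
qed (auto simp: Field_def)

lemma minimals_below:
  assumes "finite_poset P" and "x \<in> Field P"
  shows "\<exists>m \<in> minimals P (Field P). (m, x) \<in> P"
proof -
  have po: "refl_on (Field P) P" "trans P" "antisym P" and fin: "finite (Field P)"
    using assms(1)
    by (auto simp: finite_poset_def partial_order_on_def preorder_on_def)
  let ?down = "\<lambda>x. {z. (z, x) \<in> P}"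
  have fd: "finite (?down y)" for y
    by (rule finite_subset[OF _ fin]) (auto simp: Field_def)
  show ?thesis
    using assms(2)
  proof (induction "card (?down x)" arbitrary: x rule: less_induct)
    case less
    show ?case
    proof (cases "x \<in> minimals P (Field P)")
      case True
      then show ?thesis using po(1) less.prems by (auto dest: refl_onD)
    next
      case False
      then obtain y where y: "y \<in> Field P" "(y, x) \<in> P" "y \<noteq> x"
        using less.prems by (auto simp: minimals_def)
      have "x \<in> ?down x" using po(1) less.prems by (auto dest: refl_onD)
      moreover have "x \<notin> ?down y" using po(3) y by (auto dest: antisymD)
      moreover have "?down y \<subseteq> ?down x" using po(2) y by (auto dest: transD)
      ultimately have "?down y \<subset> ?down x" by blast
      then have "card (?down y) < card (?down x)" by (rule psubset_card_mono[OF fd])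
      from less.hyps[OF this y(1)] show ?thesis using po(2) y(2) by (blast dest: transD)
    qed
  qed
qed

text \<open>A point with positive index has its predecessor in the same chain below it, so it is not
  minimal.\<close>

lemma lam_minimal:
  assumes "section_width3 c P" and "x \<in> level P 0"
  shows "lam c P x = 0"
proof -
  have inj: "inj_on (\<lambda>(k, j). c k j) ({..height P} \<times> {..<3})"
    and F: "Field P = (\<lambda>(k, j). c k j) ` ({..height P} \<times> {..<3})"
    and step: "\<And>j k. j < 3 \<Longrightarrow> k < height P \<Longrightarrow> (c k j, c (k + 1) j) \<in> P"
    using assms(1) by (auto simp: section_width3_def)
  have uniq: "k = k'" if "c k j = c k' j'" "k \<le> height P" "k' \<le> height P" "j < 3" "j' < 3"
    for k k' j j'
    using inj_onD[OF inj, of "(k, j)" "(k', j')"] that by simp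
  have x: "x \<in> Field P" "\<And>y. y \<in> Field P \<Longrightarrow> (y, x) \<in> P \<Longrightarrow> y = x"
    using assms(2) by (auto simp: minimals_def)
  obtain k j where kj: "k \<le> height P" "j < 3" "x = c k j" using x(1) F by auto
  have "k = 0"
  proof (cases k)
    case (Suc m)
    have "(c m j, x) \<in> P" using step[of j m] kj Suc by simp
    then have "c m j = c k j" using x(2) kj(3) by (auto simp: Field_def)
    then show ?thesis using uniq kj Suc by fastforce
  qed
  show ?thesis
    unfolding lam_def
  proof (rule the_equality)
    show "0 \<le> height P \<and> (\<exists>j<3. x = c 0 j)" using kj \<open>k = 0\<close> by auto
  next
    fix m assume "m \<le> height P \<and> (\<exists>j<3. x = c m j)"
    then show "m = 0" using uniq kj \<open>k = 0\<close> by fastforce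
  qed
qed

section \<open>The shape of a 4-crown stack\<close>

lemma level_subset_Field: "level R k \<subseteq> Field R"
  by (cases k) (auto simp: minimals_def)

lemma level_antichain: "x \<in> level R k \<Longrightarrow> y \<in> level R k \<Longrightarrow> (x, y) \<in> R \<Longrightarrow> x = y"
  by (cases k) (auto simp: minimals_def)

lemma level_Suc_not_below:
  assumes "x \<in> level R (Suc k)" and "y \<in> level R k"
  shows "(x, y) \<notin> R"
proof
  assume xy: "(x, y) \<in> R"
  have x: "x \<in> Field R" "\<And>i. i \<le> k \<Longrightarrow> x \<notin> level R i"
    using assms(1) by (auto simp: minimals_def)
  have "x = y" using assms(2) x xy by (cases k) (auto simp: minimals_def)
  then show False using x(2)[of k] assms(2) by simp
qed

lemma crown_2E:
  assumes "crown 2 Q"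
  obtains a b u v where "a \<noteq> b" "u \<noteq> v" "{a, b} \<inter> {u, v} = {}" "Field Q = {a, b, u, v}"
    "{a, b} \<times> {u, v} \<subseteq> Q"
proof -
  obtain x :: "nat \<Rightarrow> nat \<Rightarrow> 'a" where
    inj: "inj_on (\<lambda>(i, j). x i j) ({..<2} \<times> {0, 1})" and
    Q: "Q = Id_on ((\<lambda>(i, j). x i j) ` ({..<2} \<times> {0, 1}))
            \<union> {(x i 0, x i 1) |i. i < 2}
            \<union> {(x ((i + 1) mod 2) 0, x i 1) |i. i < 2}"
    using assms unfolding crown_def by blast
  have ne: "x i j \<noteq> x i' j'" if "(i, j) \<noteq> (i', j')" "i < 2" "i' < 2" "j \<in> {0, 1}" "j' \<in> {0, 1}"
    for i j i' j'
    using inj_onD[OF inj, of "(i, j)" "(i', j')"] that by auto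
  have two: "{..<2::nat} = {0, 1}" by auto
  have less2: "i < 2 \<longleftrightarrow> i = 0 \<or> i = 1" for i :: nat by auto
  have S: "(\<lambda>(i, j). x i j) ` ({..<2} \<times> {0, 1}) = {x 0 0, x 1 0, x 0 1, x 1 1}"
    unfolding two by auto
  have E: "{(x i 0, x i 1) |i. i < 2} = {(x 0 0, x 0 1), (x 1 0, x 1 1)}"
    "{(x ((i + 1) mod 2) 0, x i 1) |i. i < 2} = {(x 1 0, x 0 1), (x 0 0, x 1 1)}"
    by (auto simp: less2 intro: exI[of _ 0] exI[of _ 1])
  show ?thesis
  proof
    show "x 0 0 \<noteq> x 1 0" "x 0 1 \<noteq> x 1 1" "{x 0 0, x 1 0} \<inter> {x 0 1, x 1 1} = {}"
      by (auto dest: ne[THEN notE, rotated -1])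
    show "Field Q = {x 0 0, x 1 0, x 0 1, x 1 1}"
      unfolding Q S E by (auto simp: Field_def Id_on_def)
    show "{x 0 0, x 1 0} \<times> {x 0 1, x 1 1} \<subseteq> Q"
      unfolding Q S E by auto
  qed
qed

text \<open>A crown on two consecutive levels could a priori mix the levels. It does not, because each
  level is an antichain and no point lies below a point of the preceding level. So the lower points
  of the crown form the lower level.\<close>

lemma crown_levels:
  assumes "Partial_order R" and "crown 2 (level_pair R k (Suc k))"
  obtains a b u v where "a \<noteq> b" "level R k = {a, b}" "level R (Suc k) = {u, v}"
    "{a, b} \<times> {u, v} \<subseteq> R"
proof -
  obtain a b u v where d: "a \<noteq> b" "u \<noteq> v" "{a, b} \<inter> {u, v} = {}"
    and F: "Field (level_pair R k (Suc k)) = {a, b, u, v}"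
    and Q: "{a, b} \<times> {u, v} \<subseteq> level_pair R k (Suc k)"
    using crown_2E[OF assms(2)] by metis
  have "refl_on (Field R) R"
    using assms(1) by (auto simp: partial_order_on_def preorder_on_def)
  then have "Field (level_pair R k (Suc k)) = level R k \<union> level R (Suc k)"
    unfolding level_pair_def by (intro Field_Restr_refl Un_least level_subset_Field)
  then have U: "level R k \<union> level R (Suc k) = {a, b, u, v}" using F by simp
  have R: "{a, b} \<times> {u, v} \<subseteq> R" using Q by (auto simp: level_pair_def)
  have dis: "level R k \<inter> level R (Suc k) = {}" by (auto simp: minimals_def)
  have low: "x \<in> level R k" if "x \<in> {a, b}" for x
  proof (rule ccontr)
    assume "x \<notin> level R k"
    then have "x \<in> level R (Suc k)" using U that by auto
    moreover have "(x, u) \<in> R" "x \<noteq> u" using R d that by auto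
    moreover have "u \<in> level R k \<or> u \<in> level R (Suc k)" using U by auto
    ultimately show False by (metis level_antichain level_Suc_not_below)
  qed
  have up: "x \<in> level R (Suc k)" if "x \<in> {u, v}" for x
  proof (rule ccontr)
    assume "x \<notin> level R (Suc k)"
    then have "x \<in> level R k" using U that by auto
    moreover have "(a, x) \<in> R" "x \<noteq> a" using R d that by auto
    ultimately show False using low[of a] by (metis insertI1 level_antichain)
  qed
  have sub: "{a, b} \<subseteq> level R k" "{u, v} \<subseteq> level R (Suc k)"
    by (rule subsetI, erule low) (rule subsetI, erule up)
  have "x \<in> {a, b} \<or> x \<in> {u, v}" if "x \<in> level R k \<or> x \<in> level R (Suc k)" for x
    using U that by (metis UnI1 UnI2 insert_iff singletonD)
  moreover have "x \<notin> level R (Suc k)" if "x \<in> level R k" for x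
    using dis that by (metis IntI empty_iff)
  ultimately have "level R k = {a, b}" "level R (Suc k) = {u, v}"
    using sub by (metis subsetD subsetI subset_antisym)+
  from that[OF d(1) this R] show ?thesis .
qed

text \<open>The relation of a stack is generated by its crowns, so every point lies in one of the levels
  up to the height. Chaining the crowns downwards from there reaches both bottom points.\<close>

lemma four_crown_stack_bottom:
  assumes "four_crown_stack R"
  obtains a b where "a \<noteq> b" "level R 0 = {a, b}"
    "\<And>y. y \<in> Field R \<Longrightarrow> y \<notin> {a, b} \<Longrightarrow> (a, y) \<in> R \<and> (b, y) \<in> R"
proof -
  have po: "Partial_order R" and h: "1 \<le> height R"
    and cr: "\<And>k. k < height R \<Longrightarrow> crown 2 (level_pair R k (Suc k))"
    and R: "R = (\<Union>k \<in> {..<height R}. level_pair R k (k + 1))\<^sup>+"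
    using assms by (auto simp: four_crown_stack_def finite_poset_def)
  have tr: "trans R" using po by (auto simp: partial_order_on_def preorder_on_def)
  obtain a b where ab: "a \<noteq> b" "level R 0 = {a, b}"
    using crown_levels[OF po cr[of 0]] h by (metis One_nat_def Suc_le_lessD)
  have above: "(z, y) \<in> R"
    if "k < height R" "y \<in> level R (Suc k)" "z \<in> {a, b}" for k y z
    using that(1,2)
  proof (induction k arbitrary: y)
    case 0
    from crown_levels[OF po cr[OF 0(1)]] ab(2) 0(2) that(3) show ?case
      by (metis SigmaI subsetD)
  next
    case (Suc k)
    from crown_levels[OF po cr[OF Suc.prems(1)]] obtain w where
      w: "w \<in> level R (Suc k)" "(w, y) \<in> R"
      using Suc.prems(2) by (metis SigmaI insertI1 subsetD)
    have "(z, w) \<in> R" using Suc.IH[OF _ w(1)] Suc.prems(1) by simp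
    then show ?case using w(2) tr by (blast dest: transD)
  qed
  have "Field R \<subseteq> Field (\<Union>k \<in> {..<height R}. level_pair R k (k + 1))"
    by (subst R) (auto simp: Field_def trancl_domain trancl_range)
  also have "\<dots> \<subseteq> (\<Union>k \<in> {..<height R}. level R k \<union> level R (Suc k))"
    by (auto simp: Field_def level_pair_def)
  finally have cover: "Field R \<subseteq> (\<Union>k \<in> {..<height R}. level R k \<union> level R (Suc k))" .
  have "(z, y) \<in> R" if y: "y \<in> Field R" "y \<notin> {a, b}" and z: "z \<in> {a, b}" for y z
  proof -
    obtain k where k: "k < height R" "y \<in> level R k \<or> y \<in> level R (Suc k)"
      using cover y(1) by auto
    have "\<exists>m < height R. y \<in> level R (Suc m)"
      using k y(2) ab(2) by (cases k) (auto intro: Suc_lessD)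
    then show ?thesis using above z by blast
  qed
  then show ?thesis using that[OF ab] by blast
qed

section \<open>Isomorphic copies of a 4-crown stack\<close>

lemma Field_image: "Field (map_prod f f ` R) = f ` Field R"
  by (force simp: Field_def)

lemma image_rel_iff:
  assumes "inj_on f (Field R)" "x \<in> Field R" "y \<in> Field R"
  shows "(f x, f y) \<in> map_prod f f ` R \<longleftrightarrow> (x, y) \<in> R"
proof
  assume "(f x, f y) \<in> map_prod f f ` R"
  then obtain u v where uv: "(u, v) \<in> R" "f u = f x" "f v = f y" by auto
  then have "u \<in> Field R" "v \<in> Field R" by (auto simp: Field_def)
  then show "(x, y) \<in> R" using uv assms by (metis inj_onD)
qed auto

lemma minimals_image:
  assumes inj: "inj_on f (Field R)" and A: "A \<subseteq> Field R"
  shows "minimals (map_prod f f ` R) (f ` A) = f ` minimals R A"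
proof -
  have "f x \<in> minimals (map_prod f f ` R) (f ` A) \<longleftrightarrow> x \<in> minimals R A" if "x \<in> A" for x
    using that A image_rel_iff[OF inj] inj_on_eq_iff[OF inj]
    unfolding minimals_def by (auto simp: subset_iff)
  moreover have "minimals (map_prod f f ` R) (f ` A) \<subseteq> f ` A" "minimals R A \<subseteq> A"
    by (auto simp: minimals_def)
  ultimately show ?thesis by blast
qed

lemma level_image:
  assumes inj: "inj_on f (Field R)"
  shows "level (map_prod f f ` R) k = f ` level R k"
proof (induction k rule: less_induct)
  case (less k)
  show ?case
  proof (cases k)
    case 0
    then show ?thesis by (simp add: Field_image minimals_image[OF inj])
  next
    case (Suc m)
    have "(\<Union>i \<in> {..m}. level (map_prod f f ` R) i) = f ` (\<Union>i \<in> {..m}. level R i)"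
      using less.IH Suc by auto
    then have "Field (map_prod f f ` R) - (\<Union>i \<in> {..m}. level (map_prod f f ` R) i)
      = f ` (Field R - (\<Union>i \<in> {..m}. level R i))"
      using inj_on_image_set_diff[OF inj, of "Field R" "\<Union>i \<in> {..m}. level R i"] level_subset_Field
      by (metis Diff_subset Field_image UN_least)
    then show ?thesis by (simp add: Suc minimals_image[OF inj])
  qed
qed

lemma Restr_image:
  assumes inj: "inj_on f (Field R)" and A: "A \<subseteq> Field R"
  shows "Restr (map_prod f f ` R) (f ` A) = map_prod f f ` Restr R A"
proof
  show "Restr (map_prod f f ` R) (f ` A) \<subseteq> map_prod f f ` Restr R A"
  proof
    fix p assume "p \<in> Restr (map_prod f f ` R) (f ` A)"
    then have p: "p \<in> map_prod f f ` R" "p \<in> f ` A \<times> f ` A" by (simp_all only: Int_iff)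
    from p(2) obtain x y where xy: "p = (f x, f y)" "x \<in> A" "y \<in> A" by blast
    from p(1) have "(f x, f y) \<in> map_prod f f ` R" by (simp only: xy(1))
    then have "(x, y) \<in> R"
      by (simp only: image_rel_iff[OF inj subsetD[OF A xy(2)] subsetD[OF A xy(3)]])
    then have "(x, y) \<in> Restr R A" using xy(2,3) by simp
    then have "map_prod f f (x, y) \<in> map_prod f f ` Restr R A" by (rule imageI)
    then show "p \<in> map_prod f f ` Restr R A" by (simp add: xy(1))
  qed
next
  show "map_prod f f ` Restr R A \<subseteq> Restr (map_prod f f ` R) (f ` A)" by fast
qed

lemma level_pair_image:
  assumes inj: "inj_on f (Field R)"
  shows "level_pair (map_prod f f ` R) k l = map_prod f f ` level_pair R k l"
  unfolding level_pair_def level_image[OF inj] image_Un [symmetric]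
  by (intro Restr_image[OF inj] Un_least level_subset_Field)

lemma height_image:
  assumes inj: "inj_on f (Field R)"
  shows "height (map_prod f f ` R) = height R"
proof -
  have sub: "C \<subseteq> Field S" if "C \<in> Chains S" for C and S :: "'c rel"
    using that by (auto simp: Chains_def Field_def)
  have 1: "f ` C \<in> Chains (map_prod f f ` R)" if "C \<in> Chains R" for C
    using that by (auto simp: Chains_def)
  have 2: "\<exists>C \<in> Chains R. D = f ` C" if D: "D \<in> Chains (map_prod f f ` R)" for D
  proof -
    have "D \<subseteq> f ` Field R" using sub[OF D] by (simp add: Field_image)
    then obtain C where C: "C \<subseteq> Field R" "D = f ` C" by (auto simp: subset_image_iff)
    then have "C \<in> Chains R"
      using D image_rel_iff[OF inj] by (auto simp: Chains_def subset_iff)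
    then show ?thesis using C by blast
  qed
  have "Chains (map_prod f f ` R) = (`) f ` Chains R" using 1 2 by blast
  moreover have "card (f ` C) = card C" if "C \<in> Chains R" for C
    by (rule card_image[OF inj_on_subset[OF inj sub[OF that]]])
  ultimately have "(\<lambda>C. card C - 1) ` Chains (map_prod f f ` R) = (\<lambda>C. card C - 1) ` Chains R"
    by (auto simp: image_image)
  then show ?thesis by (simp add: height_def)
qed

text \<open>Injectivity ensures that paths in the image are images of paths: without it, identified end
  points could join edges that do not meet in \<open>S\<close>.\<close>

lemma trancl_image:
  assumes inj: "inj_on f (Field S)"
  shows "(map_prod f f ` S)\<^sup>+ = map_prod f f ` (S\<^sup>+)"
proof
  have "(p, q) \<in> map_prod f f ` (S\<^sup>+)" if "(p, q) \<in> (map_prod f f ` S)\<^sup>+" for p q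
    using that
  proof induction
    case (base q)
    then show ?case by auto
  next
    case (step q q')
    then obtain x y y' z where xy: "(x, y) \<in> S\<^sup>+" "p = f x" "q = f y"
      and yz: "(y', z) \<in> S" "q = f y'" "q' = f z" by auto
    have "y \<in> Field S" using xy(1) by (metis FieldI2 trancl_range RangeI Range_iff Field_def UnI2)
    moreover have "y' \<in> Field S" using yz(1) by (rule FieldI1)
    ultimately have "y = y'" using inj xy yz by (metis inj_onD)
    then have "(x, z) \<in> S\<^sup>+" using xy yz by auto
    then show ?case using xy yz by auto
  qed
  then show "(map_prod f f ` S)\<^sup>+ \<subseteq> map_prod f f ` (S\<^sup>+)" by auto
  have "(f x, f y) \<in> (map_prod f f ` S)\<^sup>+" if "(x, y) \<in> S\<^sup>+" for x y
    using that
  proof induction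
    case (base y)
    then show ?case by auto
  next
    case (step y z)
    then show ?case by (auto intro: trancl_into_trancl)
  qed
  then show "map_prod f f ` (S\<^sup>+) \<subseteq> (map_prod f f ` S)\<^sup>+" by auto
qed

lemma crown_image:
  assumes "crown n Q" and inj: "inj_on f (Field Q)"
  shows "crown n (map_prod f f ` Q)"
proof -
  let ?I = "{..<n} \<times> {0, 1::nat}"
  obtain x :: "nat \<Rightarrow> nat \<Rightarrow> 'a" where n: "2 \<le> n"
    and injx: "inj_on (\<lambda>(i, j). x i j) ?I" and
    Q: "Q = Id_on ((\<lambda>(i, j). x i j) ` ?I) \<union> {(x i 0, x i 1) |i. i < n}
            \<union> {(x ((i + 1) mod n) 0, x i 1) |i. i < n}"
    using assms(1) unfolding crown_def by blast
  have sub: "(\<lambda>(i, j). x i j) ` ?I \<subseteq> Field Q" by (auto simp: Q Field_def)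
  have comp: "f \<circ> (\<lambda>(i, j). x i j) = (\<lambda>(i, j). f (x i j))" by auto
  have "inj_on (\<lambda>(i, j). f (x i j)) ?I"
    using comp_inj_on[OF injx inj_on_subset[OF inj sub]] unfolding comp .
  moreover have "map_prod f f ` Id_on A = Id_on (f ` A)" for A by (auto simp: Id_on_def)
  then have "map_prod f f ` Q = Id_on ((\<lambda>(i, j). f (x i j)) ` ?I)
      \<union> {(f (x i 0), f (x i 1)) |i. i < n} \<union> {(f (x ((i + 1) mod n) 0), f (x i 1)) |i. i < n}"
    unfolding Q image_Un image_comp comp by auto
  ultimately show ?thesis
    unfolding crown_def using n by (intro conjI exI[of _ "\<lambda>i j. f (x i j)"]) auto
qed

lemma finite_poset_image:
  assumes "finite_poset R" and inj: "inj_on f (Field R)"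
  shows "finite_poset (map_prod f f ` R)"
proof -
  have fin: "finite (Field R)" and po: "refl_on (Field R) R" "trans R" "antisym R"
    using assms(1) by (auto simp: finite_poset_def partial_order_on_def preorder_on_def)
  note iff = image_rel_iff[OF inj]
  have "refl_on (f ` Field R) (map_prod f f ` R)"
    using po(1) by (auto simp: refl_on_def)
  moreover have "antisym (map_prod f f ` R)"
  proof (rule antisymI)
    fix p q assume pq: "(p, q) \<in> map_prod f f ` R" "(q, p) \<in> map_prod f f ` R"
    then obtain x y where xy: "(x, y) \<in> R" "p = f x" "q = f y" by auto
    moreover from xy have "x \<in> Field R" "y \<in> Field R" by (auto simp: Field_def)
    ultimately have "(y, x) \<in> R" using pq(2) iff by auto
    then show "p = q" using xy po(3) by (auto dest: antisymD)
  qed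
  moreover have "trans (map_prod f f ` R)"
  proof (rule transI)
    fix p q s assume pq: "(p, q) \<in> map_prod f f ` R" "(q, s) \<in> map_prod f f ` R"
    then obtain x y where xy: "(x, y) \<in> R" "p = f x" "q = f y" by auto
    moreover obtain z where z: "s = f z" "z \<in> Field R"
      using pq(2) by (auto simp: Field_def)
    moreover from xy have "x \<in> Field R" "y \<in> Field R" by (auto simp: Field_def)
    ultimately have "(y, z) \<in> R" using pq(2) iff by auto
    then have "(x, z) \<in> R" using xy po(2) by (auto dest: transD)
    then show "(p, s) \<in> map_prod f f ` R" using xy z by auto
  qed
  moreover have "map_prod f f ` R \<subseteq> f ` Field R \<times> f ` Field R" by (auto simp: Field_def)
  ultimately show ?thesis
    using fin by (auto simp: finite_poset_def partial_order_on_def preorder_on_def Field_image)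
qed

lemma four_crown_stack_image:
  assumes "four_crown_stack R" and inj: "inj_on f (Field R)"
  shows "four_crown_stack (map_prod f f ` R)"
proof -
  let ?U = "\<Union>k \<in> {..<height R}. level_pair R k (k + 1)"
  have R: "R = ?U\<^sup>+"
    using assms(1) by (simp add: four_crown_stack_def)
  have sub: "Field (level_pair R k l) \<subseteq> Field R" for k l
    by (auto simp: level_pair_def Field_def)
  have "Field ?U \<subseteq> Field R" by (auto simp: level_pair_def Field_def)
  then have "(map_prod f f ` ?U)\<^sup>+ = map_prod f f ` (?U\<^sup>+)"
    by (intro trancl_image inj_on_subset[OF inj])
  then have "map_prod f f ` R = (\<Union>k \<in> {..<height R}. map_prod f f ` level_pair R k (k + 1))\<^sup>+"
    using R by (simp add: image_UN)
  moreover have "crown 2 (map_prod f f ` level_pair R k (k + 1))" if "k < height R" for k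
    using assms(1) that
    by (intro crown_image inj_on_subset[OF inj sub]) (auto simp: four_crown_stack_def)
  ultimately show ?thesis
    using assms(1) unfolding four_crown_stack_def height_image[OF inj] level_pair_image[OF inj]
    by (intro conjI finite_poset_image[OF _ inj]) simp_all
qed

section \<open>Splitting at the bottom level\<close>

text \<open>A retract may be moved along any monotone section of a monotone map onto it. This form allows
  the retract and the map onto it to be changed independently of each other.\<close>

lemma retraction_section:
  assumes R: "Partial_order R"
    and g: "g ` Field R \<subseteq> Field P" "\<And>x y. (x, y) \<in> R \<Longrightarrow> (g x, g y) \<in> P"
    and s: "s ` Field P \<subseteq> Field R" "\<And>x y. (x, y) \<in> P \<Longrightarrow> (s x, s y) \<in> R"
    and sg: "\<And>y. y \<in> Field R \<Longrightarrow> s (g y) = y"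
  shows "retraction (g \<circ> s) P (map_prod g g ` R)"
proof -
  have sP: "s ` Field P = Field R" using g(1) s(1) sg by (force simp: image_iff)
  have im: "(g \<circ> s) ` Field P = g ` Field R" by (simp only: image_comp [symmetric] sP)
  have "map_prod g g ` R = Restr P (g ` Field R)"
  proof
    show "map_prod g g ` R \<subseteq> Restr P (g ` Field R)"
      using g(2) by (auto simp: Field_def)
    show "Restr P (g ` Field R) \<subseteq> map_prod g g ` R"
      using s(2) sg by (force simp: image_iff)
  qed
  then show ?thesis
    unfolding retraction_def im using g s sg by (auto simp: image_subset_iff)
qed

text \<open>The bottom of the stack is moved by \<open>g\<close>, which replaces \<open>a\<close> and \<open>b\<close>
  by minimal points \<open>a'\<close> and \<open>b'\<close> below them. The retraction is changed to
  \<open>s\<close>, which pulls the stray minimal points down to \<open>a\<close>. Points of the stack outside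
  its bottom level lie above \<open>a\<close>, so they are not minimal in \<open>P\<close> and \<open>s\<close>
  still fixes them. Hence \<open>g\<close> is a section of \<open>s\<close>, and \<open>g \<circ> s\<close> is the
  wanted retraction.\<close>

lemma split_at_bottom:
  assumes P: "finite_poset P" and R: "four_crown_stack R" and r: "retraction r P R"
  obtains R' r' where "four_crown_stack R'" "retraction r' P R'"
    "level R' 0 \<subseteq> level P 0" "r' ` level P 0 = level R' 0" "card (level R' 0) = 2"
proof -
  have po: "refl_on (Field P) P" "trans P" "antisym P"
    using P by (auto simp: finite_poset_def partial_order_on_def preorder_on_def)
  have rP: "\<And>x. x \<in> Field P \<Longrightarrow> r x \<in> Field P" "\<And>x. x \<in> Field P \<Longrightarrow> r (r x) = r x"
    "\<And>x y. (x, y) \<in> P \<Longrightarrow> (r x, r y) \<in> P" and Rdef: "R = Restr P (r ` Field P)"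
    using r by (auto simp: retraction_def)
  have FR: "Field R = r ` Field P"
    unfolding Rdef by (rule Field_Restr_refl[OF po(1)]) (use rP(1) in blast)
  have RP: "R \<subseteq> P" using Rdef by blast
  have fix_r: "r y = y" if "y \<in> Field R" for y using that rP FR by auto
  have rR: "(r x, r y) \<in> R" if "(x, y) \<in> P" for x y
    using that rP(3)[OF that] Rdef by (auto simp: Field_def)
  have poR: "Partial_order R"
    using R by (auto simp: four_crown_stack_def finite_poset_def)
  obtain a b where ab: "a \<noteq> b" "level R 0 = {a, b}"
    and above: "\<And>y. y \<in> Field R \<Longrightarrow> y \<notin> {a, b} \<Longrightarrow> (a, y) \<in> R \<and> (b, y) \<in> R"
    using four_crown_stack_bottom[OF R] by blast
  have abF: "a \<in> Field R" "b \<in> Field R" using level_subset_Field[of R 0] ab(2) by auto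
  have bot: "x = z" if "(x, z) \<in> R" "z \<in> {a, b}" for x z
    using that ab(2) by (auto simp: minimals_def Field_def)
  obtain a' b' where a': "a' \<in> level P 0" "(a', a) \<in> P" and b': "b' \<in> level P 0" "(b', b) \<in> P"
    using minimals_below[OF P] abF FR rP(1) by (metis imageE level.simps(1))
  have ra: "r a' = a" using rR[OF a'(2)] bot fix_r[OF abF(1)] by auto
  have rb: "r b' = b" using rR[OF b'(2)] bot fix_r[OF abF(2)] by auto
  have minP: "x = y" if "(x, y) \<in> P" "y \<in> level P 0" for x y
    using that by (auto simp: minimals_def Field_def)
  have nomin: "y \<notin> level P 0" if "y \<in> Field R" "y \<notin> {a, b}" for y
    using above[OF that] RP minP that(2) by blast
  define g where "g y = (if y = a then a' else if y = b then b' else y)" for y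
  define s where "s x = (if x \<in> level P 0 \<and> r x \<notin> {a, b} then a else r x)" for x
  have g_le: "(g y, y) \<in> P" if "y \<in> Field R" for y
    using that a' b' po(1) FR rP(1) by (auto simp: g_def dest: refl_onD)
  have g_mono: "(g x, g y) \<in> P" if "(x, y) \<in> R" for x y
  proof (cases "y \<in> {a, b}")
    case True
    then have "x = y" using bot that by blast
    then show ?thesis using g_le[of y] that po(1) by (auto simp: Field_def dest: refl_onD)
  next
    case False
    then have "g y = y" by (auto simp: g_def)
    moreover have "(g x, x) \<in> P" using g_le that by (auto simp: Field_def)
    ultimately show ?thesis using that RP po(2) by (auto dest: transD)
  qed
  have s_Field: "s x \<in> Field R" if "x \<in> Field P" for x
    using that FR abF by (auto simp: s_def)
  have s_mono: "(s x, s y) \<in> R" if "(x, y) \<in> P" for x y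
  proof (cases "y \<in> level P 0")
    case True
    then have "x = y" using minP that by blast
    moreover have "s y \<in> Field R" using that s_Field by (auto simp: Field_def)
    ultimately show ?thesis
      using poR by (auto simp: partial_order_on_def preorder_on_def dest: refl_onD)
  next
    case False
    then have sy: "s y = r y" by (simp add: s_def)
    show ?thesis
    proof (cases "s x = r x")
      case True
      then show ?thesis using sy rR that by simp
    next
      case False
      then have x: "s x = a" "r x \<notin> {a, b}" by (auto simp: s_def split: if_splits)
      have "r y \<notin> {a, b}" using bot[OF rR[OF that]] x(2) by auto
      moreover have "r y \<in> Field R" using rR[OF that] by (auto simp: Field_def)
      ultimately show ?thesis using above x(1) sy by simp
    qed
  qed
  have sg: "s (g y) = y" if "y \<in> Field R" for y
    using that nomin[OF that] ra rb ab(1) fix_r[OF that] by (auto simp: g_def s_def)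
  have gF: "g ` Field R \<subseteq> Field P"
    using g_le by (auto simp: Field_def)
  have inj: "inj_on g (Field R)" using sg by (metis inj_onI)
  let ?R' = "map_prod g g ` R"
  have lev: "level ?R' 0 = {a', b'}"
    using level_image[OF inj, of 0] ab by (auto simp: g_def simp del: level.simps)
  have "a' \<noteq> b'" using ra rb ab(1) by auto
  show ?thesis
  proof
    show "four_crown_stack ?R'" by (rule four_crown_stack_image[OF R inj])
    show "retraction (g \<circ> s) P ?R'"
      by (rule retraction_section[OF poR gF g_mono _ s_mono sg]) (auto simp: s_Field)
    show "level ?R' 0 \<subseteq> level P 0" using lev a'(1) b'(1) by auto
    show "card (level ?R' 0) = 2" using lev \<open>a' \<noteq> b'\<close> by simp
    have "(g \<circ> s) x \<in> {a', b'}" if "x \<in> level P 0" for x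
      using that by (auto simp: g_def s_def simp del: level.simps)
    moreover have "(g \<circ> s) a' = a'" "(g \<circ> s) b' = b'"
      using ra rb ab(1) by (auto simp: g_def s_def)
    ultimately show "(g \<circ> s) ` level P 0 = level ?R' 0"
      unfolding lev using a'(1) b'(1) by (metis (no_types, lifting) empty_subsetI image_subsetI
        insert_subset rev_image_eqI subset_antisym)
  qed
qed

theorem mainTheorem5:
  fixes c :: "nat \<Rightarrow> nat \<Rightarrow> 'a" and P :: "'a rel"
  assumes "crowned_section c P"
  shows "(\<exists>R. four_crown_stack R \<and> retract R P) \<longleftrightarrow>
    (\<exists>R r. four_crown_stack R \<and> retraction r P R \<and> (\<exists>l \<le> height R. split_level c P r R l))"
proof
  assume "\<exists>R. four_crown_stack R \<and> retract R P"
  then obtain R r where R: "four_crown_stack R" "retraction r P R" by (auto simp: retract_def)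
  have sec: "section_width3 c P" using assms by (simp add: crowned_section_def)
  then have P: "finite_poset P" by (simp add: section_width3_def)
  from split_at_bottom[OF P R] obtain R' r' where R': "four_crown_stack R'" "retraction r' P R'"
    and lev: "level R' 0 \<subseteq> level P 0" "r' ` level P 0 = level R' 0" "card (level R' 0) = 2"
    by blast
  obtain a b where ab: "level R' 0 = {a, b}" using lev(3) by (auto simp: card_2_iff)
  have "lam c P a = 0" "lam c P b = 0" using lam_minimal[OF sec] lev(1) ab by blast+
  moreover have "0 < height R'" using R'(1) by (simp add: four_crown_stack_def)
  moreover have "level_range Q 0 0 = level Q 0" for Q :: "'a rel"
    by (simp add: level_range_def)
  ultimately have "down_split_level c P r' R' 0"
    unfolding down_split_level_def using ab lev(2)
    by (intro conjI exI[of _ a] exI[of _ b]) simp_all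
  then show "\<exists>R r. four_crown_stack R \<and> retraction r P R \<and> (\<exists>l \<le> height R. split_level c P r R l)"
    using R' by (auto simp: split_level_def)
next
  assume "\<exists>R r. four_crown_stack R \<and> retraction r P R \<and> (\<exists>l \<le> height R. split_level c P r R l)"
  then show "\<exists>R. four_crown_stack R \<and> retract R P" by (auto simp: retract_def)
qed

end
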